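(* If $B_4$ is the (weak) Bruhat graph of order $4$, then $\pi(B_4)=64$.
   Context: The (weak) Bruhat graph of order $m$ has as its vertices the permutations of $\{1,\ldots,m\}$ (written as sequences); two vertices are adjacent if the corresponding permutations differ by an adjacent transposition, i.e., by swapping the entries in two consecutive positions. A configuration on a connected graph $G$ is a function $p:V(G)\to\mathbb{N}\cup\{0\}$; its size is $|p|=\sum_{v}p(v)$. A pebbling move removes two pebbles from some vertex and places one pebble on an adjacent vertex. For a root $r\in V(G)$, $p$ is solvable for $(G,r)$ if some (possibly empty) sequence of pebbling moves from $p$ yields a configuration with at least one pebble on $r$. The pebbling number $\pi(G)$ is the least integer $k$ such that for every vertex $v$, every configuration of size $k$ is solvable for $(G,v)$. *)

theory Defs
  imports "HOL-Combinatorics.Multiset_Permutations"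
begin

(* A graph is given by a finite vertex set V and a symmetric irreflexive adjacency relation adj.
   A configuration is a function on the whole vertex type; only its values on V count towards
   its size, and moves neither use nor change the values outside V. *)

definition config_size :: "'a set \<Rightarrow> ('a \<Rightarrow> nat) \<Rightarrow> nat" where
  "config_size V p = (\<Sum>v\<in>V. p v)"

definition pebbling_move ::
  "'a set \<Rightarrow> ('a \<Rightarrow> 'a \<Rightarrow> bool) \<Rightarrow> ('a \<Rightarrow> nat) \<Rightarrow> ('a \<Rightarrow> nat) \<Rightarrow> bool" where
  "pebbling_move V adj p q \<longleftrightarrow>
     (\<exists>u\<in>V. \<exists>v\<in>V. adj u v \<and> 2 \<le> p u \<and> q = p(u := p u - 2, v := p v + 1))"

definition solvable ::
  "'a set \<Rightarrow> ('a \<Rightarrow> 'a \<Rightarrow> bool) \<Rightarrow> 'a \<Rightarrow> ('a \<Rightarrow> nat) \<Rightarrow> bool" where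
  "solvable V adj r p \<longleftrightarrow> (\<exists>q. (pebbling_move V adj)\<^sup>*\<^sup>* p q \<and> 1 \<le> q r)"

definition pebbling_number :: "'a set \<Rightarrow> ('a \<Rightarrow> 'a \<Rightarrow> bool) \<Rightarrow> nat" where
  "pebbling_number V adj =
     (LEAST k. \<forall>r\<in>V. \<forall>p. config_size V p = k \<longrightarrow> solvable V adj r p)"

definition bruhat_verts :: "nat \<Rightarrow> nat list set" where
  "bruhat_verts m = permutations_of_set {1..m}"

definition bruhat_adj :: "nat list \<Rightarrow> nat list \<Rightarrow> bool" where
  "bruhat_adj xs ys \<longleftrightarrow>
     (\<exists>i. Suc i < length xs \<and> ys = xs[i := xs ! Suc i, Suc i := xs ! i])"

lemma bruhat_adj_sym:
  assumes "bruhat_adj xs ys"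
  shows "bruhat_adj ys xs"
proof -
  from assms obtain i where i: "Suc i < length xs"
    and ys: "ys = xs[i := xs ! Suc i, Suc i := xs ! i]"
    by (auto simp: bruhat_adj_def)
  have "xs = ys[i := ys ! Suc i, Suc i := ys ! i]"
    by (rule nth_equalityI) (use i in \<open>simp_all add: ys nth_list_update\<close>)
  moreover have "Suc i < length ys"
    using i by (simp add: ys)
  ultimately show ?thesis
    unfolding bruhat_adj_def by blast
qed

lemma bruhat_adj_neq:
  assumes "bruhat_adj xs ys" and "xs \<in> bruhat_verts m"
  shows "xs \<noteq> ys"
proof -
  from assms(1) obtain i where i: "Suc i < length xs"
    and ys: "ys = xs[i := xs ! Suc i, Suc i := xs ! i]"
    by (auto simp: bruhat_adj_def)
  have "distinct xs"
    using assms(2) by (simp add: bruhat_verts_def permutations_of_set_def)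
  then have "xs ! Suc i \<noteq> xs ! i"
    using i by (simp add: nth_eq_iff_index_eq)
  moreover have "ys ! Suc i = xs ! i"
    using i by (simp add: ys)
  ultimately show ?thesis
    by metis
qed

lemma bruhat_adj_verts:
  assumes "bruhat_adj xs ys" and "xs \<in> bruhat_verts m"
  shows "ys \<in> bruhat_verts m"
proof -
  from assms(1) obtain i where i: "Suc i < length xs"
    and ys: "ys = xs[i := xs ! Suc i, Suc i := xs ! i]"
    unfolding bruhat_adj_def by blast
  have "set ys = set xs" "distinct ys = distinct xs"
    unfolding ys using i by (simp_all only: set_swap distinct_swap Suc_lessD)
  with assms(2) show ?thesis
    by (simp add: bruhat_verts_def permutations_of_set_def)
qed

end

theory Submission
  imports Defs
begin

text \<open>
  \<^bold>\<open>Lower bound.\<close> Give a permutation the weight $2^{6-i}$, where $i$ is its number of inversions.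
  An adjacent transposition changes $i$ by one, so a pebbling move, which costs two pebbles, never
  increases the total weight. A pebble on the identity weighs 64, and a pebble on the reversed
  permutation weighs 1: fewer than 64 pebbles piled up there cannot reach the identity.

  \<^bold>\<open>Upper bound.\<close> Renaming values commutes with exchanging positions, hence is an automorphism
  of the graph, and acts transitively on the vertices. So the root may be taken to be the identity, and only moves that remove an inversion
  are needed. The engine is a weight inequality (lemma \<open>tree_bound\<close>): let \<open>T\<close> be a tree
  hanging from the root in which a parent weighs at least twice as much as its child. Push pebbles
  up the tree, starting from the far end and moving as many as possible. Weight is lost only where
  an odd pebble stays behind, and if the root remains empty then nothing else is left over. Hence
  in an unsolvable configuration the pebbles on \<open>T\<close> weigh at most as much as the vertices of
  \<open>T\<close> other than the root, and the leaves with an even number of pebbles need not be counted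
  among these vertices.

  Averaging these inequalities over trees of shortest paths bounds the size of an unsolvable
  configuration, but by no less than 65. To bound the size, the averaged weight must be at least 1
  everywhere, and so at least 3 and 5 on the permutations with five and with four inversions, where
  a single path has only 2 and 4. The missing two pebbles come from parity: in a configuration
  close to that bound, nearly every leaf of nearly every tree must carry an odd number of pebbles.
  This is exploited by a finite case distinction on parities and sizes of single stacks. Every
  case ends with a nonnegative combination of tree inequalities which shows that the configuration
  has fewer pebbles than it should. In some cases a few moves have to be made before the
  combination applies, typically because pebbles from the reversed permutation must be divided
  between two of its neighbours, whereas a tree sends them all the same way.

  The case distinction is a term \<open>certificate\<close>. A checker for such terms is proved sound
  (\<open>refutes_sound\<close>), and evaluating it by rewriting proves the upper bound for the identity
  (\<open>certificate_refutes\<close>).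
\<close>

section \<open>Moving pebbles in an arbitrary graph\<close>

lemma solvable_root:
  assumes "1 \<le> p r"
  shows "solvable V adj r p"
  unfolding solvable_def using assms by blast

lemma solvable_move:
  assumes "pebbling_move V adj p q" "solvable V adj r q"
  shows "solvable V adj r p"
  using assms unfolding solvable_def by (meson converse_rtranclp_into_rtranclp)

lemma solvable_moves:
  assumes "u \<in> V" "v \<in> V" "adj u v" "u \<noteq> v" "2 * k \<le> p u"
    and "solvable V adj r (p(u := p u - 2 * k, v := p v + k))"
  shows "solvable V adj r p"
  using assms(5,6)
proof (induction k arbitrary: p)
  case 0
  then show ?case by simp
next
  case (Suc k)
  let ?q = "p(u := p u - 2, v := p v + 1)"
  have "pebbling_move V adj p ?q"
    unfolding pebbling_move_def using assms(1-3) Suc.prems(1) by (intro bexI[of _ u] bexI[of _ v]) auto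
  moreover have "solvable V adj r ?q"
  proof (rule Suc.IH)
    show "2 * k \<le> ?q u"
      using Suc.prems(1) \<open>u \<noteq> v\<close> by simp
    have eq: "?q(u := ?q u - 2 * k, v := ?q v + k) = p(u := p u - 2 * Suc k, v := p v + Suc k)"
      using \<open>u \<noteq> v\<close> by (auto simp: fun_eq_iff)
    show "solvable V adj r (?q(u := ?q u - 2 * k, v := ?q v + k))"
      by (subst eq) (rule Suc.prems(2))
  qed
  ultimately show ?case by (rule solvable_move)
qed

text \<open>The map needs to preserve edges in one direction only, so that a copy of a subgraph with oriented
edges suffices to transport a solution. Values outside \<open>V\<close> are irrelevant, which is why the
induction follows all configurations that agree with the given one on the image of \<open>V\<close>.\<close>

lemma solvable_embedding:
  assumes inj: "inj_on f V" and im: "f ` V \<subseteq> V'"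
    and adj: "\<And>u v. u \<in> V \<Longrightarrow> v \<in> V \<Longrightarrow> adj u v \<Longrightarrow> adj' (f u) (f v)"
    and r: "r \<in> V" and sol: "solvable V adj r (p \<circ> f)"
  shows "solvable V' adj' (f r) p"
proof -
  obtain q where q: "(pebbling_move V adj)\<^sup>*\<^sup>* (p \<circ> f) q" "1 \<le> q r"
    using sol unfolding solvable_def by blast
  have "solvable V' adj' (f r) p'" if "(pebbling_move V adj)\<^sup>*\<^sup>* s q" "\<forall>x\<in>V. p' (f x) = s x" for s p'
    using that
  proof (induction arbitrary: p' rule: converse_rtranclp_induct)
    case base
    then show ?case using q(2) r by (intro solvable_root) simp
  next
    case (step s t)
    then obtain u v where uv: "u \<in> V" "v \<in> V" "adj u v" "2 \<le> s u"
      "t = s(u := s u - 2, v := s v + 1)"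
      unfolding pebbling_move_def by blast
    let ?t = "p'(f u := p' (f u) - 2, f v := p' (f v) + 1)"
    have "pebbling_move V' adj' p' ?t"
      unfolding pebbling_move_def using uv im adj step.prems by (intro bexI[of _ "f u"] bexI[of _ "f v"]) auto
    moreover have "\<forall>x\<in>V. ?t (f x) = t x"
      using uv step.prems inj by (auto simp: inj_on_eq_iff)
    then have "solvable V' adj' (f r) ?t" by (rule step.IH)
    ultimately show ?case by (rule solvable_move)
  qed
  from this[OF q(1)] show ?thesis by simp
qed

text \<open>A move from \<open>u\<close> to \<open>v\<close> loses \<open>2 * h u\<close> and gains \<open>h v\<close>, so the total weight never
increases, and in the end the root alone contributes \<open>h r\<close>.\<close>

lemma weight_of_solvable:
  fixes h :: "'a \<Rightarrow> nat"
  assumes fin: "finite V" and r: "r \<in> V"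
    and irr: "\<And>v. v \<in> V \<Longrightarrow> \<not> adj v v"
    and h: "\<And>u v. u \<in> V \<Longrightarrow> v \<in> V \<Longrightarrow> adj u v \<Longrightarrow> h v \<le> 2 * h u"
    and sol: "solvable V adj r p"
  shows "h r \<le> (\<Sum>v\<in>V. h v * p v)"
proof -
  obtain q where q: "(pebbling_move V adj)\<^sup>*\<^sup>* p q" "1 \<le> q r"
    using sol unfolding solvable_def by blast
  have "h r * 1 \<le> h r * q r" using q(2) by (rule mult_le_mono2)
  also have "\<dots> \<le> (\<Sum>v\<in>V. h v * q v)"
    using member_le_sum[of r V "\<lambda>v. h v * q v"] fin r by simp
  also have "\<dots> \<le> (\<Sum>v\<in>V. h v * p v)"
    using q(1)
  proof (induction rule: rtranclp_induct)
    case base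
    then show ?case by simp
  next
    case (step s t)
    then obtain u v where uv: "u \<in> V" "v \<in> V" "adj u v" "2 \<le> s u"
      "t = s(u := s u - 2, v := s v + 1)"
      unfolding pebbling_move_def by blast
    have "u \<noteq> v" using irr uv by blast
    have split: "(\<Sum>x\<in>V. g x) = g u + g v + (\<Sum>x\<in>V - {u} - {v}. g x)" for g :: "'a \<Rightarrow> nat"
      using fin uv(1,2) \<open>u \<noteq> v\<close> by (simp add: sum.remove[of V u] sum.remove[of "V - {u}" v])
    have "h u * (s u - 2) + h v * (s v + 1) \<le> h u * s u + h v * s v"
    proof -
      obtain k where "s u = k + 2" using uv(4) by (metis le_add_diff_inverse2)
      then show ?thesis using h[OF uv(1-3)] by (simp add: algebra_simps)
    qed
    then have "(\<Sum>x\<in>V. h x * t x) \<le> (\<Sum>x\<in>V. h x * s x)"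
      unfolding split[of "\<lambda>x. h x * t x"] split[of "\<lambda>x. h x * s x"]
      using \<open>u \<noteq> v\<close> by (simp add: uv(5))
    with step.IH show ?case by simp
  qed
  finally show ?thesis by simp
qed

text \<open>A tree as a list of pairs (child, parent). The order matters: an edge comes before the edge that
leaves its parent, so that reading the list from left to right empties every vertex only after all
of its children have been emptied.\<close>

fun weighted_tree :: "('a \<Rightarrow> 'a \<Rightarrow> bool) \<Rightarrow> ('a \<Rightarrow> nat) \<Rightarrow> 'a \<Rightarrow> ('a \<times> 'a) list \<Rightarrow> bool" where
  "weighted_tree adj w r [] \<longleftrightarrow> True"
| "weighted_tree adj w r ((v, u) # es) \<longleftrightarrow>
     adj v u \<and> 2 * w v \<le> w u \<and> v \<noteq> u \<and> v \<noteq> r \<and> v \<notin> fst ` set es \<and> v \<notin> snd ` set es \<and>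
     (u = r \<or> u \<in> fst ` set es) \<and> weighted_tree adj w r es"

text \<open>The set \<open>S\<close> is fixed while the induction consumes the list of edges: a vertex outside \<open>S\<close>
never receives a pebble, and therefore keeps exactly the remainder of its original stack.\<close>

lemma tree_bound_aux:
  assumes "weighted_tree adj w r es" "set es \<subseteq> V \<times> V" "snd ` set es \<subseteq> S"
    and "\<not> solvable V adj r p"
  shows "(\<Sum>v\<in>fst ` set es. w v * p v)
    \<le> (\<Sum>v\<in>fst ` set es. w v * (if v \<in> S then 1 else p v mod 2))"
  using assms
proof (induction adj w r es arbitrary: p rule: weighted_tree.induct)
  case (1 adj w r)
  then show ?case by simp
next
  case (2 adj w r v u es)
  define T where "T = fst ` set es"
  have edge: "adj v u" "2 * w v \<le> w u" "v \<noteq> u" "v \<in> V" "u \<in> V" "u \<in> S"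
    and tree: "weighted_tree adj w r es" and v: "v \<notin> T" and u: "u = r \<or> u \<in> T" and "finite T"
    using 2(2-4) by (auto simp: T_def)
  \<comment> \<open>The child \<open>v\<close> has received all it ever will; it now sends as much as it can to its parent.\<close>
  define k where "k = p v div 2"
  define q where "q = p(v := p v - 2 * k, u := p u + k)"
  have q: "q u = p u + k" "\<And>x. x \<noteq> u \<Longrightarrow> x \<noteq> v \<Longrightarrow> q x = p x"
    using edge(3) by (auto simp: q_def)
  have unsol: "\<not> solvable V adj r q"
    using 2(5) solvable_moves[of v V u adj k p r] edge by (auto simp: k_def q_def)
  have "q r = 0"
    using unsol solvable_root[of q r] by (metis One_nat_def not_less_eq_eq le_zero_eq)
  have gain: "(\<Sum>x\<in>T. w x * p x) + 2 * w v * k \<le> (\<Sum>x\<in>T. w x * q x)"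
  proof (cases "u \<in> T")
    case False
    \<comment> \<open>The parent is the root, which must stay empty.\<close>
    then have "k = 0" using \<open>q r = 0\<close> q(1) u by auto
    moreover have "(\<Sum>x\<in>T. w x * q x) = (\<Sum>x\<in>T. w x * p x)"
      using v q(2) False by (intro sum.cong) metis+
    ultimately show ?thesis by simp
  next
    case True
    have "(\<Sum>x\<in>T - {u}. w x * q x) = (\<Sum>x\<in>T - {u}. w x * p x)"
      using v q(2) by (intro sum.cong) auto
    moreover have "2 * w v * k \<le> w u * k" using edge(2) by (rule mult_le_mono1)
    ultimately show ?thesis
      using True \<open>finite T\<close> by (simp add: sum.remove[of T u] q(1) algebra_simps)
  qed
  have "(\<Sum>x\<in>T. w x * q x) \<le> (\<Sum>x\<in>T. w x * (if x \<in> S then 1 else q x mod 2))"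
    using 2(1)[OF tree _ _ unsol] 2(3,4) by (simp add: T_def)
  also have "\<dots> = (\<Sum>x\<in>T. w x * (if x \<in> S then 1 else p x mod 2))"
    using v edge(6) q(2) by (intro sum.cong) metis+
  finally have rest: "(\<Sum>x\<in>T. w x * p x) + 2 * w v * k
      \<le> (\<Sum>x\<in>T. w x * (if x \<in> S then 1 else p x mod 2))"
    using gain by linarith
  have "p v = p v mod 2 + 2 * k" by (simp add: k_def)
  then have "w v * p v = w v * (p v mod 2) + 2 * w v * k"
    by (metis distrib_left mult.assoc mult.left_commute)
  moreover have "w v * (p v mod 2) \<le> w v * (if v \<in> S then 1 else p v mod 2)"
    by (intro mult_le_mono2) auto
  moreover have "fst ` set ((v, u) # es) = insert v T" by (simp add: T_def)
  ultimately show ?case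
    using rest v \<open>finite T\<close> by (simp only: sum.insert not_False_eq_True)
qed

text \<open>What remains on a vertex after the sweep is 0 or 1. For a leaf it is the parity of its stack; for
an inner vertex, whose stack changes on the way, only the bound 1 is available.\<close>

lemma tree_bound:
  assumes "weighted_tree adj w r es" "set es \<subseteq> V \<times> V" "\<not> solvable V adj r p"
  shows "(\<Sum>v\<in>fst ` set es. w v * p v)
    \<le> (\<Sum>v\<in>fst ` set es. w v * (if v \<in> snd ` set es then 1 else p v mod 2))"
  using tree_bound_aux[OF assms(1,2) order_refl assms(3)] .

section \<open>Checkable proofs of solvability\<close>

text \<open>Tree inequalities for the vertex set \<open>{..<n}\<close> with root 0, as vectors of coefficients. The
coefficient of a vertex is split into a part that always counts on the right-hand side and a part
that counts there only for an odd stack.\<close>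

definition pebbling_cut :: "(nat \<times> nat) set \<Rightarrow> nat \<Rightarrow> (int \<times> int) list \<Rightarrow> bool" where
  "pebbling_cut E n c \<longleftrightarrow> length c = n \<and> (\<forall>v<n. 0 \<le> snd (c ! v)) \<and>
     (\<forall>q. \<not> solvable {..<n} (\<lambda>u v. (u, v) \<in> E) 0 q \<longrightarrow>
        (\<Sum>v<n. (fst (c ! v) + snd (c ! v)) * int (q v))
          \<le> (\<Sum>v<n. fst (c ! v) + snd (c ! v) * int (q v mod 2)))"

definition tree_cut :: "nat \<Rightarrow> (nat \<Rightarrow> nat) \<Rightarrow> (nat \<times> nat) list \<Rightarrow> (int \<times> int) list" where
  "tree_cut n w es = map (\<lambda>v. if v \<notin> fst ` set es then (0, 0)
     else if v \<in> snd ` set es then (int (w v), 0) else (0, int (w v))) [0..<n]"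

lemma pebbling_cut_tree_cut:
  assumes tree: "weighted_tree (\<lambda>u v. (u, v) \<in> E) w 0 es" and es: "set es \<subseteq> {..<n} \<times> {..<n}"
  shows "pebbling_cut E n (tree_cut n w es)"
  unfolding pebbling_cut_def
proof (intro conjI allI impI)
  let ?c = "tree_cut n w es"
  define T S where "T = fst ` set es" and "S = snd ` set es"
  have T: "T \<subseteq> {..<n}" using es by (auto simp: T_def)
  have less: "v < n" if "v \<in> T" for v
    using T that by blast
  have c: "?c ! v = (if v \<notin> T then (0, 0) else if v \<in> S then (int (w v), 0) else (0, int (w v)))"
    if "v < n" for v
    using that by (simp add: tree_cut_def T_def S_def)
  show "length ?c = n" by (simp add: tree_cut_def)
  show "0 \<le> snd (?c ! v)" if "v < n" for v
    using that by (simp add: c)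
  fix q assume unsol: "\<not> solvable {..<n} (\<lambda>u v. (u, v) \<in> E) 0 q"
  have "(\<Sum>v<n. (fst (?c ! v) + snd (?c ! v)) * int (q v)) = (\<Sum>v\<in>T. int (w v * q v))"
    by (rule sum.mono_neutral_cong_right) (use T in \<open>auto simp: c less\<close>)
  also have "\<dots> \<le> (\<Sum>v\<in>T. int (w v * (if v \<in> S then 1 else q v mod 2)))"
    using tree_bound[OF tree es unsol, folded T_def S_def]
    by (simp only: of_nat_sum[symmetric] of_nat_le_iff)
  also have "\<dots> = (\<Sum>v<n. fst (?c ! v) + snd (?c ! v) * int (q v mod 2))"
    by (rule sum.mono_neutral_cong_left) (use T in \<open>auto simp: c less\<close>)
  finally show "(\<Sum>v<n. (fst (?c ! v) + snd (?c ! v)) * int (q v))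
      \<le> (\<Sum>v<n. fst (?c ! v) + snd (?c ! v) * int (q v mod 2))" .
qed

text \<open>A box describes what is known about a configuration in the current case: for every vertex an
arithmetic progression, given by its first member, an upper bound and its step, that contains the
number of pebbles.\<close>

type_synonym box = "(int \<times> int \<times> int) list"

definition in_box :: "(nat \<Rightarrow> nat) \<Rightarrow> box \<Rightarrow> bool" where
  "in_box q B \<longleftrightarrow> (\<forall>v<length B. case B ! v of (l, h, s) \<Rightarrow>
     l \<le> int (q v) \<and> int (q v) \<le> h \<and> s dvd int (q v) - l)"

lemma in_box_nth:
  assumes "in_box q B" "v < length B" "B ! v = (l, h, s)"
  shows "l \<le> int (q v)" "int (q v) \<le> h" "s dvd int (q v) - l"
  using assms by (auto simp: in_box_def)

lemma in_box_update:
  assumes "in_box q B" "l \<le> int x" "int x \<le> h" "s dvd int x - l"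
  shows "in_box (q(v := x)) (B[v := (l, h, s)])"
  using assms by (auto simp: in_box_def nth_list_update)

fun known_even :: "int \<times> int \<times> int \<Rightarrow> bool" where
  "known_even (l, h, s) \<longleftrightarrow> even l \<and> (s = 2 \<or> l = h)"

lemma known_even_in_box:
  assumes "in_box q B" "v < length B" "known_even (B ! v)"
  shows "q v mod 2 = 0"
proof -
  obtain l h s where lhs: "B ! v = (l, h, s)" by (cases "B ! v")
  note q = in_box_nth[OF assms(1,2) lhs]
  have "even (int (q v))"
  proof (cases "l = h")
    case True
    then show ?thesis using q assms(3) by (simp add: lhs)
  next
    case False
    then have "s = 2" "even l" using assms(3) by (auto simp: lhs)
    then show ?thesis using q(3) by simp
  qed
  then show ?thesis by presburger
qed

definition cut_bound :: "box \<Rightarrow> (int \<times> int) list \<Rightarrow> int" where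
  "cut_bound B c = sum_list (map2 (\<lambda>b (a, e). if known_even b then a else a + e) B c)"

text \<open>A linear form is maximal at one of the two ends in every coordinate, depending on the sign of its
coefficient.\<close>

definition box_max :: "box \<Rightarrow> int list \<Rightarrow> int" where
  "box_max B xs = sum_list (map2 (\<lambda>(l, h, s) x. max (x * l) (x * h)) B xs)"

fun residual :: "(int \<times> int) list list \<Rightarrow> (int \<times> nat) list \<Rightarrow> int list \<Rightarrow> int list" where
  "residual cs [] xs = xs"
| "residual cs ((y, i) # ys) xs = residual cs ys (map2 (\<lambda>x (a, e). x - y * (a + e)) xs (cs ! i))"

text \<open>A refutation of the existence of an unsolvable configuration with many pebbles.
\<open>Close d ys\<close> ends a case with a linear combination: \<open>d\<close> is the multiplier of the size, so
that fractional multipliers can be written with integers, and the pairs in \<open>ys\<close> are the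
multiplier and the position of a tree inequality. \<open>Parity\<close> distinguishes an even from an odd
stack, \<open>Threshold v k\<close> a stack of fewer than \<open>k\<close> from one of at least \<open>k\<close> pebbles, and
\<open>Move u v k\<close> performs \<open>k\<close> moves from \<open>u\<close> to \<open>v\<close>.\<close>

datatype refutation =
    Close int "(int \<times> nat) list"
  | Parity nat refutation refutation
  | Threshold nat int refutation refutation
  | Move nat nat nat refutation

text \<open>The last argument is a lower bound for the size, which decreases with every move. After a case
distinction the ends of the progression are adjusted, so that the bounds stay sharp. In
\<open>Close\<close>, the size times \<open>d\<close> is written as the chosen combination plus a remainder, and both
are bounded from above.\<close>

fun refutes :: "(nat \<times> nat) set \<Rightarrow> (int \<times> int) list list \<Rightarrow> refutation \<Rightarrow> box \<Rightarrow> int \<Rightarrow> bool" where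
  "refutes E cs (Close d ys) B t \<longleftrightarrow>
     0 \<le> d \<and> (\<forall>(y, i)\<in>set ys. 0 \<le> y \<and> i < length cs) \<and>
     box_max B (residual cs ys (replicate (length B) d))
       + sum_list (map (\<lambda>(y, i). y * cut_bound B (cs ! i)) ys) < d * t"
| "refutes E cs (Parity v R S) B t \<longleftrightarrow> v < length B \<and>
     (case B ! v of (l, h, s) \<Rightarrow>
        refutes E cs R (B[v := (l + l mod 2, h - h mod 2, 2)]) t \<and>
        refutes E cs S (B[v := (l + 1 - l mod 2, h - 1 + h mod 2, 2)]) t)"
| "refutes E cs (Threshold v k R S) B t \<longleftrightarrow> v < length B \<and>
     (case B ! v of (l, h, s) \<Rightarrow> s dvd k - l \<and>
        refutes E cs R (B[v := (l, k - s, s)]) t \<and>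
        refutes E cs S (B[v := (k, h, s)]) t)"
| "refutes E cs (Move u v k R) B t \<longleftrightarrow>
     u < length B \<and> v < length B \<and> u \<noteq> v \<and> (u, v) \<in> E \<and>
     (case B ! u of (l, h, s) \<Rightarrow> case B ! v of (l', h', s') \<Rightarrow>
        2 * int k \<le> l \<and>
        refutes E cs R
          (B[u := (l - 2 * int k, h - 2 * int k, s), v := (l' + int k, h' + int k, s')])
          (t - int k))"

lemma sum_list_map2:
  "length xs = n \<Longrightarrow> length ys = n \<Longrightarrow>
    sum_list (map2 f xs ys) = (\<Sum>v<n. f (xs ! v) (ys ! v))" for f :: "'a \<Rightarrow> 'b \<Rightarrow> int"
  by (simp add: sum_list_sum_nth atLeast0LessThan)

lemma cut_bound_in_box:
  assumes cut: "pebbling_cut E n c" and box: "in_box q B" "length B = n"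
    and unsol: "\<not> solvable {..<n} (\<lambda>u v. (u, v) \<in> E) 0 q"
  shows "(\<Sum>v<n. (fst (c ! v) + snd (c ! v)) * int (q v)) \<le> cut_bound B c"
proof -
  have c: "length c = n" "\<And>v. v < n \<Longrightarrow> 0 \<le> snd (c ! v)"
    using cut by (auto simp: pebbling_cut_def)
  have "(\<Sum>v<n. (fst (c ! v) + snd (c ! v)) * int (q v))
      \<le> (\<Sum>v<n. fst (c ! v) + snd (c ! v) * int (q v mod 2))"
    using cut unsol by (auto simp: pebbling_cut_def)
  also have "\<dots> \<le> (\<Sum>v<n. if known_even (B ! v) then fst (c ! v) else fst (c ! v) + snd (c ! v))"
  proof (rule sum_mono)
    fix v assume "v \<in> {..<n}"
    then have v: "v < n" by simp
    have "snd (c ! v) * int (q v mod 2) \<le> snd (c ! v) * 1"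
      using c(2)[OF v] by (intro mult_left_mono) auto
    then show "fst (c ! v) + snd (c ! v) * int (q v mod 2)
        \<le> (if known_even (B ! v) then fst (c ! v) else fst (c ! v) + snd (c ! v))"
      using known_even_in_box[OF box(1), of v] box(2) v by simp
  qed
  also have "\<dots> = cut_bound B c"
    unfolding cut_bound_def sum_list_map2[OF box(2) c(1)] by (simp add: case_prod_unfold)
  finally show ?thesis .
qed

lemma residual_sum:
  assumes "\<forall>(y, i)\<in>set ys. i < length cs" "\<forall>c\<in>set cs. length c = n" "length xs = n"
  shows "length (residual cs ys xs) = n"
    and "(\<Sum>v<n. residual cs ys xs ! v * z v)
      = (\<Sum>v<n. xs ! v * z v)
        - (\<Sum>(y, i)\<leftarrow>ys. y * (\<Sum>v<n. (fst (cs ! i ! v) + snd (cs ! i ! v)) * z v))"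
proof -
  have "length (residual cs ys xs) = n \<and> (\<Sum>v<n. residual cs ys xs ! v * z v)
      = (\<Sum>v<n. xs ! v * z v)
        - (\<Sum>(y, i)\<leftarrow>ys. y * (\<Sum>v<n. (fst (cs ! i ! v) + snd (cs ! i ! v)) * z v))"
    using assms(1,3)
  proof (induction ys arbitrary: xs)
    case Nil
    then show ?case by simp
  next
    case (Cons yi ys)
    obtain y i where yi: "yi = (y, i)" by (cases yi)
    have len: "length (cs ! i) = n" using assms(2) Cons.prems(1) yi by simp
    let ?xs = "map2 (\<lambda>x (a, e). x - y * (a + e)) xs (cs ! i)"
    have "(\<Sum>v<n. ?xs ! v * z v)
        = (\<Sum>v<n. xs ! v * z v - y * ((fst (cs ! i ! v) + snd (cs ! i ! v)) * z v))"
      using len Cons.prems(2) by (intro sum.cong) (auto simp: case_prod_unfold algebra_simps)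
    then have "(\<Sum>v<n. ?xs ! v * z v)
        = (\<Sum>v<n. xs ! v * z v) - y * (\<Sum>v<n. (fst (cs ! i ! v) + snd (cs ! i ! v)) * z v)"
      by (simp add: sum_subtractf sum_distrib_left)
    moreover have "length ?xs = n" using len Cons.prems(2) by simp
    ultimately show ?case
      using Cons.IH[of ?xs] Cons.prems(1) by (simp add: yi)
  qed
  then show "length (residual cs ys xs) = n"
    and "(\<Sum>v<n. residual cs ys xs ! v * z v)
      = (\<Sum>v<n. xs ! v * z v)
        - (\<Sum>(y, i)\<leftarrow>ys. y * (\<Sum>v<n. (fst (cs ! i ! v) + snd (cs ! i ! v)) * z v))"
    by auto
qed

lemma box_max_upper:
  assumes box: "in_box q B" "length B = n" and xs: "length xs = n"
  shows "(\<Sum>v<n. xs ! v * int (q v)) \<le> box_max B xs"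
proof -
  have "(\<Sum>v<n. xs ! v * int (q v)) \<le> (\<Sum>v<n. case B ! v of (l, h, s) \<Rightarrow> max (xs ! v * l) (xs ! v * h))"
  proof (rule sum_mono)
    fix v assume "v \<in> {..<n}"
    then have v: "v < length B" using box(2) by simp
    obtain l h s where lhs: "B ! v = (l, h, s)" by (cases "B ! v")
    note q = in_box_nth[OF box(1) v lhs]
    have "xs ! v * int (q v) \<le> max (xs ! v * l) (xs ! v * h)"
    proof (cases "0 \<le> xs ! v")
      case True
      then show ?thesis using mult_left_mono[OF q(2), of "xs ! v"] by simp
    next
      case False
      then have "xs ! v \<le> 0" by simp
      from mult_left_mono_neg[OF q(1) this] show ?thesis by simp
    qed
    then show "xs ! v * int (q v) \<le> (case B ! v of (l, h, s) \<Rightarrow> max (xs ! v * l) (xs ! v * h))"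
      by (simp add: lhs)
  qed
  also have "\<dots> = box_max B xs"
    unfolding box_max_def sum_list_map2[OF box(2) xs] by (simp add: case_prod_unfold)
  finally show ?thesis .
qed

text \<open>An unsolvable configuration could be followed through the certificate: every case distinction
leads it into one of the two branches, and moves keep it unsolvable. It would arrive at some
\<open>Close\<close>, where the combination of inequalities contradicts the lower bound for its size.\<close>

theorem refutes_sound:
  assumes cuts: "\<forall>c\<in>set cs. pebbling_cut E n c"
    and "refutes E cs R B t" "in_box q B" "length B = n" "t \<le> (\<Sum>v<n. int (q v))"
  shows "solvable {..<n} (\<lambda>u v. (u, v) \<in> E) 0 q"
  using assms(2-)
proof (induction R arbitrary: B t q)
  case (Close d ys)
  show ?case
  proof (rule ccontr)
    assume unsol: "\<not> ?thesis"
    let ?r = "residual cs ys (replicate n d)"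
    have ys: "\<forall>(y, i)\<in>set ys. i < length cs" using Close.prems(1) by auto
    have len: "\<forall>c\<in>set cs. length c = n" using cuts by (auto simp: pebbling_cut_def)
    note r = residual_sum[OF ys len, of "replicate n d"]
    have "(\<Sum>(y, i)\<leftarrow>ys. y * (\<Sum>v<n. (fst (cs ! i ! v) + snd (cs ! i ! v)) * int (q v)))
        \<le> (\<Sum>(y, i)\<leftarrow>ys. y * cut_bound B (cs ! i))"
    proof (rule sum_list_mono, clarify)
      fix y i assume "(y, i) \<in> set ys"
      then have "0 \<le> y" "cs ! i \<in> set cs" using Close.prems(1) by auto
      then show "y * (\<Sum>v<n. (fst (cs ! i ! v) + snd (cs ! i ! v)) * int (q v))
          \<le> y * cut_bound B (cs ! i)"
        using cuts Close.prems(2,3) unsol by (intro mult_left_mono cut_bound_in_box) auto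
    qed
    moreover have "(\<Sum>v<n. ?r ! v * int (q v)) \<le> box_max B ?r"
      using Close.prems(2,3) r(1) by (intro box_max_upper) auto
    moreover have "d * t \<le> (\<Sum>v<n. replicate n d ! v * int (q v))"
    proof -
      have "d * t \<le> d * (\<Sum>v<n. int (q v))"
        using Close.prems(1,4) by (intro mult_left_mono) auto
      then show ?thesis by (simp add: sum_distrib_left)
    qed
    ultimately show False
      using Close.prems(1,3) r(2)[of "\<lambda>v. int (q v)"] by simp
  qed
next
  case (Parity v R S)
  obtain l h s where lhs: "B ! v = (l, h, s)" by (cases "B ! v")
  have v: "v < length B" using Parity.prems(1) by simp
  note q = in_box_nth[OF Parity.prems(2) v lhs]
  show ?case
  proof (cases "even (q v)")
    case True
    then have "l + l mod 2 \<le> int (q v)" "int (q v) \<le> h - h mod 2" "2 dvd int (q v) - (l + l mod 2)"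
      using q(1,2) by presburger+
    then have "in_box q (B[v := (l + l mod 2, h - h mod 2, 2)])"
      using in_box_update[OF Parity.prems(2), of "l + l mod 2" "q v" "h - h mod 2" 2 v] q by simp
    from Parity.IH(1)[where t = t, OF _ this] show ?thesis
      using Parity.prems(1,3,4) by (simp add: lhs)
  next
    case False
    then have "l + 1 - l mod 2 \<le> int (q v)" "int (q v) \<le> h - 1 + h mod 2"
      "2 dvd int (q v) - (l + 1 - l mod 2)"
      using q(1,2) by presburger+
    then have "in_box q (B[v := (l + 1 - l mod 2, h - 1 + h mod 2, 2)])"
      using in_box_update[OF Parity.prems(2), of "l + 1 - l mod 2" "q v" "h - 1 + h mod 2" 2 v] q by simp
    from Parity.IH(2)[where t = t, OF _ this] show ?thesis
      using Parity.prems(1,3,4) by (simp add: lhs)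
  qed
next
  case (Threshold v k R S)
  obtain l h s where lhs: "B ! v = (l, h, s)" by (cases "B ! v")
  have v: "v < length B" and k: "s dvd k - l" using Threshold.prems(1) by (auto simp: lhs)
  note q = in_box_nth[OF Threshold.prems(2) v lhs]
  have d: "s dvd k - int (q v)" using dvd_diff[OF k q(3)] by simp
  show ?case
  proof (cases "int (q v) < k")
    case True
    then have "s \<le> k - int (q v)" using d by (intro zdvd_imp_le) auto
    then have "in_box q (B[v := (l, k - s, s)])"
      using in_box_update[OF Threshold.prems(2), of "l" "q v" "k - s" s v] q by simp
    from Threshold.IH(1)[where t = t, OF _ this] show ?thesis
      using Threshold.prems(1,3,4) by (simp add: lhs)
  next
    case False
    have "s dvd int (q v) - k" "k \<le> int (q v)" using d False by (simp_all add: dvd_diff_commute)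
    then have "in_box q (B[v := (k, h, s)])"
      using in_box_update[OF Threshold.prems(2), of "k" "q v" "h" s v] q by simp
    from Threshold.IH(2)[where t = t, OF _ this] show ?thesis
      using Threshold.prems(1,3,4) by (simp add: lhs)
  qed
next
  case (Move u v k R)
  obtain l h s where lhs: "B ! u = (l, h, s)" by (cases "B ! u")
  obtain l' h' s' where lhs': "B ! v = (l', h', s')" by (cases "B ! v")
  have uv: "u < length B" "v < length B" "u \<noteq> v" "(u, v) \<in> E" "2 * int k \<le> l"
    and R: "refutes E cs R
      (B[u := (l - 2 * int k, h - 2 * int k, s), v := (l' + int k, h' + int k, s')]) (t - int k)"
    using Move.prems(1) by (auto simp: lhs lhs')
  note qu = in_box_nth[OF Move.prems(2) uv(1) lhs] and qv = in_box_nth[OF Move.prems(2) uv(2) lhs']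
  have k: "2 * k \<le> q u" using qu(1) uv(5) by linarith
  let ?q = "q(u := q u - 2 * k, v := q v + k)"
  have "in_box (q(u := q u - 2 * k)) (B[u := (l - 2 * int k, h - 2 * int k, s)])"
    by (rule in_box_update[OF Move.prems(2)]) (use qu k in \<open>simp_all add: of_nat_diff\<close>)
  then have box: "in_box ?q (B[u := (l - 2 * int k, h - 2 * int k, s), v := (l' + int k, h' + int k, s')])"
    by (rule in_box_update) (use qv in simp_all)
  have split: "(\<Sum>x<n. g x) = g u + g v + (\<Sum>x\<in>{..<n} - {u} - {v}. g x)" for g :: "nat \<Rightarrow> int"
    using uv(1-3) Move.prems(3) by (simp add: sum.remove[of "{..<n}" u] sum.remove[of "{..<n} - {u}" v])
  have "t - int k \<le> (\<Sum>x<n. int (?q x))"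
    using Move.prems(4) uv(3) k
    unfolding split[of "\<lambda>x. int (?q x)"] split[of "\<lambda>x. int (q x)"] by (simp add: of_nat_diff)
  then have "solvable {..<n} (\<lambda>u v. (u, v) \<in> E) 0 ?q"
    by (rule Move.IH[OF R box, rotated]) (simp_all only: length_list_update Move.prems(3))
  then show ?case
    using uv(1-4) k Move.prems(3) by - (rule solvable_moves[where u = u and v = v and k = k], simp_all)
qed

section \<open>The certificate for the weak order on four letters\<close>

text \<open>The permutations by number of inversions: the identity has position 0 and the reversed
permutation position 23. All following data refer to these positions.\<close>

definition perms4 :: "nat list list" where
  "perms4 = [
    [1,2,3,4], [1,2,4,3], [1,3,2,4], [2,1,3,4], [1,3,4,2], [1,4,2,3], [2,1,4,3], [2,3,1,4],
    [3,1,2,4], [1,4,3,2], [2,3,4,1], [2,4,1,3], [3,1,4,2], [3,2,1,4], [4,1,2,3], [2,4,3,1],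
    [3,2,4,1], [3,4,1,2], [4,1,3,2], [4,2,1,3], [3,4,2,1], [4,2,3,1], [4,3,1,2], [4,3,2,1]]"

text \<open>The edges of the Bruhat graph, oriented towards the identity.\<close>

definition covers :: "(nat \<times> nat) list" where
  "covers = [
    (23,20), (23,21), (23,22), (22,17), (22,18), (21,15), (21,19), (20,16), (20,17), (19,11),
    (19,14), (18,9), (18,14), (17,12), (16,10), (16,13), (15,10), (15,11), (14,5), (13,7),
    (13,8), (12,4), (12,8), (11,6), (10,7), (9,4), (9,5), (8,2), (7,3), (6,1), (6,3), (5,1),
    (4,2), (3,0), (2,0), (1,0)]"

text \<open>A permutation with \<open>i\<close> inversions weighs $2^{6-i}$: the weight doubles along every edge
towards the identity, as a tree inequality requires.\<close>

definition weights :: "nat list" where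
  "weights = [64, 32,32,32, 16,16,16,16,16, 8,8,8,8,8,8, 4,4,4,4,4, 2,2,2, 1]"

text \<open>Trees of shortest paths to the identity. They need not span: leaving out branches yields
inequalities that put relatively more weight on the remaining vertices.\<close>

definition trees :: "(nat \<times> nat) list list" where
  "trees = [
   [(23,21), (21,19), (19,11), (11,6), (6,1), (1,0)],
   [(23,20), (20,16), (16,13), (13,8), (8,2), (2,0)],
   [(23,22), (22,18), (18,14), (14,5), (5,1), (1,0)],
   [(23,21), (21,15), (15,11), (11,6), (6,1), (1,0)],
   [(23,20), (20,17), (17,12), (12,8), (8,2), (2,0)],
   [(22,18), (21,15), (20,16), (18,9), (16,10), (15,10), (10,7), (9,5), (7,3), (5,1), (3,0),
   (1,0)],
   [(23,20), (22,17), (20,17), (17,12), (12,4), (4,2), (2,0)],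
   [(23,21), (21,19), (19,14), (14,5), (9,5), (5,1), (1,0)],
   [(23,21), (21,15), (19,11), (15,10), (11,6), (10,7), (7,3), (6,3), (3,0)],
   [(23,21), (21,15), (16,10), (15,10), (10,7), (7,3), (3,0)],
   [(23,20), (22,18), (21,19), (20,16), (19,14), (18,9), (16,13), (14,5), (13,7), (9,5), (7,3),
   (5,1), (3,0), (1,0)],
   [(23,21), (21,15), (19,11), (18,9), (15,11), (11,6), (9,5), (6,1), (5,1), (1,0)],
   [(23,21), (22,18), (21,19), (19,14), (18,14), (14,5), (5,1), (1,0)],
   [(23,20), (21,15), (20,16), (16,10), (15,10), (10,7), (7,3), (6,3), (3,0)],
   [(23,22), (22,18), (18,9), (9,5), (6,1), (5,1), (1,0)],
   [(23,20), (22,17), (20,17), (17,12), (13,8), (12,8), (8,2), (4,2), (2,0)],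
   [(23,21), (21,19), (19,14), (14,5), (6,1), (5,1), (1,0)],
   [(23,20), (20,16), (16,13), (13,8), (12,8), (8,2), (4,2), (2,0)],
   [(23,22), (22,18), (18,9), (14,5), (9,5), (6,1), (5,1), (1,0)],
   [(23,20), (21,15), (20,16), (16,10), (15,10), (13,7), (10,7), (7,3), (6,3), (3,0)],
   [(23,21), (21,19), (19,14), (18,14), (14,5), (6,1), (5,1), (1,0)],
   [(23,21), (21,15), (15,10), (13,7), (10,7), (7,3), (6,3), (3,0)],
   [(23,21), (21,15), (19,11), (15,11), (11,6), (6,1), (5,1), (1,0)],
   [(23,22), (22,17), (20,17), (17,12), (12,8), (8,2), (4,2), (2,0)],
   [(23,22), (22,18), (21,19), (19,14), (18,14), (14,5), (6,1), (5,1), (1,0)],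
   [(23,21), (22,18), (21,19), (19,14), (18,9), (14,5), (9,5), (6,1), (5,1), (1,0)],
   [(23,22), (22,17), (20,16), (17,12), (16,13), (13,8), (12,8), (8,2), (4,2), (2,0)],
   [(23,20), (22,17), (20,17), (17,12), (12,4), (9,4), (8,2), (4,2), (2,0)],
   [(23,21), (22,18), (21,19), (19,14), (18,14), (14,5), (9,5), (6,1), (5,1), (1,0)],
   [(23,21), (21,15), (20,16), (16,10), (15,10), (10,7), (7,3), (6,3), (3,0)],
   [(23,21), (21,19), (19,11), (15,11), (11,6), (6,1), (5,1), (1,0)],
   [(23,20), (20,16), (16,10), (15,10), (10,7), (7,3), (6,3), (3,0)],
   [(23,22), (22,18), (19,14), (18,14), (14,5), (9,5), (6,1), (5,1), (1,0)],
   [(23,20), (22,17), (20,17), (18,9), (17,12), (12,4), (9,4), (8,2), (4,2), (2,0)],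
   [(23,22), (22,17), (20,17), (17,12), (16,13), (13,8), (12,8), (8,2), (4,2), (2,0)],
   [(23,21), (21,15), (16,10), (15,10), (13,7), (10,7), (7,3), (6,3), (3,0)],
   [(23,21), (21,15), (15,10), (10,7), (7,3), (6,3), (3,0)],
   [(23,20), (20,16), (16,10), (10,7), (7,3), (6,3), (3,0)],
   [(23,22), (22,17), (20,17), (17,12), (12,4), (9,4), (8,2), (4,2), (2,0)],
   [(23,22), (22,18), (18,9), (12,4), (9,4), (8,2), (4,2), (2,0)],
   [(23,20), (20,16), (16,13), (13,7), (10,7), (7,3), (6,3), (3,0)]]"

text \<open>The multipliers at the ends of the cases are rounded dual solutions of the linear programs that
maximise the size subject to tree inequalities and to the box. The case
distinctions show first that vertices with one or two inversions are empty and that at least 41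
pebbles lie on the reversed permutation, so that there are always enough for the moves that start
there.\<close>

definition certificate :: refutation where
  "certificate =
    Threshold 1 1 (Threshold 2 1 (Threshold 3 1 (Threshold 4 1 (Threshold 5 1 (Threshold 6 1
    (Threshold 7 1 (Threshold 8 1 (Threshold 23 41 (Close 8 [(1,0), (1,6), (1,12), (2,13),
    (1,14), (1,15)]) (Threshold 9 2 (Threshold 10 2 (Threshold 11 2 (Threshold 12 2 (Threshold
    13 2 (Threshold 14 2 (Threshold 12 1 (Threshold 14 1 (Threshold 11 1 (Threshold 10 1
    (Threshold 22 1 (Threshold 18 1 (Close 8 [(1,3), (2,4), (1,13), (2,16), (1,17), (1,18)])
    (Threshold 15 2 (Threshold 16 2 (Threshold 18 2 (Threshold 19 2 (Threshold 23 49 (Close 8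
    [(2,4), (1,7), (1,12), (1,13), (1,19)]) (Parity 23 (Close 8 [(1,3), (2,4), (2,12), (1,13),
    (1,17), (1,18)]) (Threshold 13 1 (Threshold 9 1 (Threshold 17 2 (Threshold 23 55 (Close 4
    [(1,4), (1,7), (1,19)]) (Threshold 23 57 (Close 4 [(1,4), (1,7), (1,19)]) (Threshold 16 1
    (Threshold 17 1 (Threshold 20 1 (Close 3 [(2,2), (1,7), (1,9)]) (Threshold 20 2 (Close 4
    [(2,2), (1,7), (1,9)]) (Threshold 20 4 (Threshold 19 1 (Threshold 15 1 (Move 23 21 1 (Move
    23 22 2 (Move 22 18 1 (Close 1 [(1,20)])))) (Close 2 [(1,4), (1,9)])) (Move 23 20 1 (Move 23
    22 2 (Move 22 18 1 (Close 1 [(1,20)]))))) (Close 0 [(1,1)])))) (Close 4 [(2,4), (1,7),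
    (1,9)])) (Move 23 20 2 (Move 20 16 1 (Close 2 [(1,9), (1,17)])))))) (Close 4 [(2,4), (1,7),
    (1,9)])) (Close 4 [(1,4), (1,7), (1,19), (1,18)])) (Move 23 20 5 (Move 20 16 2 (Move 16 13 1
    (Close 2 [(1,21), (1,15), (1,17)]))))))) (Close 8 [(2,4), (2,12), (1,13), (1,22), (1,17),
    (1,18)])) (Close 8 [(1,3), (2,4), (2,12), (1,13), (1,17), (1,18)])) (Close 8 [(2,4), (1,9),
    (2,12), (1,13), (1,17), (1,18)])) (Close 8 [(1,3), (2,4), (1,12), (1,13), (1,22), (1,17),
    (1,18)]))) (Threshold 20 1 (Threshold 16 1 (Close 8 [(2,9), (1,16), (1,17), (2,23), (1,24),
    (1,18)]) (Threshold 16 2 (Threshold 15 2 (Threshold 18 2 (Threshold 19 2 (Threshold 23 49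
    (Close 8 [(2,9), (1,25), (1,23), (1,24), (1,26)]) (Parity 23 (Close 8 [(2,9), (1,16),
    (1,17), (2,23), (1,24), (1,18)]) (Threshold 13 1 (Threshold 9 1 (Threshold 17 2 (Threshold
    23 55 (Close 4 [(1,9), (1,23), (1,24)]) (Threshold 23 57 (Close 4 [(1,9), (1,23), (1,24)])
    (Threshold 23 59 (Threshold 21 1 (Close 4 [(1,23), (1,24)]) (Parity 21 (Close 4 [(1,9),
    (1,23), (1,24)]) (Parity 22 (Close 4 [(1,9), (1,12), (1,27)]) (Threshold 17 1 (Threshold 18
    1 (Threshold 22 3 (Close 3 [(1,7), (1,9)]) (Threshold 22 5 (Move 23 21 1 (Close 4 [(1,9),
    (1,24)])) (Close 0 [(1,2)]))) (Close 3 [(1,2), (1,9), (1,24)])) (Threshold 22 3 (Move 23 21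
    1 (Close 4 [(1,9), (1,24)])) (Close 0 [(1,6)])))))) (Threshold 17 1 (Threshold 18 1
    (Threshold 22 2 (Close 3 [(1,7), (1,9), (2,17)]) (Threshold 22 3 (Move 23 21 1 (Move 23 20 2
    (Move 20 16 1 (Close 1 [(1,9)])))) (Close 0 [(1,2)]))) (Close 0 [(1,2)])) (Close 0
    [(1,23)]))))) (Close 4 [(1,9), (2,23), (1,24)])) (Close 4 [(1,7), (1,9), (1,23), (1,18)]))
    (Move 23 20 5 (Move 20 16 2 (Move 16 13 1 (Close 2 [(1,15), (1,19)]))))))) (Close 8 [(2,22),
    (1,16), (1,17), (2,23), (1,24), (1,18)])) (Close 8 [(2,9), (1,17), (2,23), (2,24), (1,18)]))
    (Close 8 [(2,9), (1,22), (1,17), (2,23), (1,24), (1,18)])) (Close 8 [(2,9), (1,16), (1,17),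
    (2,23), (1,24), (1,18)]))) (Threshold 23 47 (Threshold 23 46 (Threshold 23 45 (Close 8
    [(1,13), (1,27), (1,19), (1,23), (2,24)]) (Threshold 9 1 (Close 8 [(1,13), (2,27), (1,19),
    (2,24)]) (Move 23 20 1 (Move 23 22 4 (Move 22 18 2 (Move 18 9 1 (Close 8 [(1,13), (2,27),
    (1,19), (2,28)]))))))) (Close 8 [(1,13), (1,27), (1,19), (1,23), (2,24)])) (Threshold 23 48
    (Threshold 9 1 (Close 8 [(1,13), (2,27), (1,19), (2,24)]) (Move 23 20 1 (Move 23 22 4 (Move
    22 18 2 (Move 18 9 1 (Close 8 [(1,13), (2,27), (1,19), (2,28)])))))) (Threshold 23 49
    (Threshold 9 1 (Close 8 [(1,13), (2,27), (1,19), (2,24)]) (Move 23 20 1 (Move 23 22 4 (Move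
    22 18 2 (Move 18 9 1 (Close 8 [(1,13), (2,27), (1,19), (2,28)])))))) (Threshold 16 2
    (Threshold 18 2 (Threshold 19 2 (Threshold 15 2 (Threshold 9 1 (Threshold 13 1 (Threshold 17
    2 (Threshold 23 60 (Threshold 23 55 (Threshold 23 54 (Threshold 23 53 (Close 4 [(1,27),
    (1,19), (1,24)]) (Threshold 21 1 (Close 4 [(1,27), (1,19), (1,24)]) (Parity 20 (Close 4
    [(1,23), (1,29), (1,24)]) (Move 23 20 1 (Close 4 [(1,23), (1,29), (1,24)]))))) (Close 4
    [(1,27), (1,19), (1,24)])) (Threshold 21 1 (Threshold 15 1 (Close 4 [(1,2), (1,7), (1,27),
    (1,17)]) (Threshold 19 1 (Close 4 [(1,2), (1,27), (1,17)]) (Threshold 23 57 (Close 4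
    [(1,27), (1,17), (1,24)]) (Move 23 21 3 (Move 21 15 1 (Close 0 [(1,30)])))))) (Threshold 23
    56 (Parity 20 (Close 4 [(1,23), (1,29), (1,24)]) (Parity 21 (Close 4 [(1,27), (1,19),
    (1,24)]) (Parity 22 (Close 4 [(1,12), (1,27), (1,19)]) (Threshold 20 3 (Threshold 16 1
    (Close 4 [(1,9), (1,27), (1,24)]) (Threshold 22 3 (Move 23 20 1 (Move 23 21 1 (Close 4
    [(1,19), (1,24)]))) (Threshold 17 1 (Threshold 22 5 (Move 23 20 1 (Move 23 21 1 (Close 4
    [(1,19), (1,24)]))) (Close 0 [(1,2)])) (Close 0 [(1,6)])))) (Threshold 22 3 (Threshold 16 1
    (Threshold 20 5 (Threshold 17 1 (Move 23 20 1 (Move 23 21 1 (Close 4 [(1,19), (1,24)])))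
    (Close 0 [(1,4)])) (Close 0 [(1,1)])) (Close 0 [(1,1)])) (Close 0 [(1,6)])))))) (Threshold
    23 57 (Parity 20 (Close 4 [(1,23), (1,29), (1,24)]) (Move 23 20 1 (Close 4 [(1,23), (1,29),
    (1,24)]))) (Parity 23 (Close 4 [(1,2), (1,3), (1,7), (1,27), (1,17)]) (Threshold 23 59
    (Threshold 16 1 (Parity 22 (Close 3 [(1,9), (1,12), (2,27)]) (Threshold 22 3 (Threshold 20 2
    (Move 23 22 1 (Close 4 [(1,9), (1,12), (1,27)])) (Threshold 17 1 (Threshold 20 4 (Threshold
    20 3 (Threshold 18 1 (Close 3 [(1,7), (1,9)]) (Move 23 21 1 (Move 23 22 2 (Move 22 18 1
    (Close 1 [(1,20)]))))) (Move 23 20 1 (Close 0 [(1,23)]))) (Close 0 [(1,1)])) (Close 0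
    [(1,4)]))) (Move 23 20 1 (Move 23 22 1 (Close 0 [(1,6)]))))) (Threshold 20 2 (Threshold 22 2
    (Threshold 17 1 (Move 23 21 1 (Move 23 20 2 (Move 20 16 1 (Close 1 [(1,9)])))) (Move 23 20 1
    (Close 0 [(1,23)]))) (Threshold 17 1 (Threshold 18 1 (Threshold 22 4 (Threshold 22 3 (Move
    23 21 1 (Move 23 20 2 (Move 20 16 1 (Close 1 [(1,9)])))) (Move 23 20 1 (Close 0 [(1,23)])))
    (Close 0 [(1,2)])) (Close 0 [(1,2)])) (Close 0 [(1,6)]))) (Close 0 [(1,1)]))) (Threshold 16
    1 (Threshold 18 1 (Threshold 19 1 (Threshold 15 1 (Threshold 17 1 (Threshold 20 3 (Threshold
    20 2 (Threshold 21 2 (Close 2 [(1,27)]) (Threshold 21 3 (Move 23 20 1 (Close 1 [(1,23)]))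
    (Close 0 [(1,0)]))) (Close 0 [(1,23)])) (Close 0 [(1,1)])) (Close 0 [(1,4)])) (Close 0
    [(1,3)])) (Close 0 [(1,0)])) (Close 0 [(1,2)])) (Close 0 [(1,1)])))))))) (Threshold 23 61
    (Close 3 [(1,2), (1,3), (1,7), (1,27), (1,17)]) (Threshold 16 1 (Threshold 19 1 (Threshold
    22 2 (Move 23 20 1 (Move 23 22 1 (Close 0 [(1,6)]))) (Close 0 [(1,2)])) (Close 0 [(1,0)]))
    (Close 0 [(1,1)])))) (Threshold 22 2 (Move 23 20 1 (Move 23 22 1 (Close 4 [(1,12), (2,27),
    (1,19)]))) (Close 4 [(1,9), (2,27), (1,24)]))) (Move 23 20 5 (Move 20 16 2 (Move 16 13 1
    (Close 3 [(1,21), (2,15), (1,19)]))))) (Move 23 20 1 (Move 23 22 4 (Move 22 18 2 (Move 18 9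
    1 (Close 4 [(1,7), (2,27), (1,28)])))))) (Threshold 15 4 (Threshold 15 3 (Threshold 9 1
    (Threshold 23 50 (Threshold 13 1 (Close 4 [(1,27), (1,19), (1,24)]) (Move 23 20 5 (Move 20
    16 2 (Move 16 13 1 (Close 2 [(1,21), (1,15), (1,19)]))))) (Close 8 [(2,2), (2,27), (1,17),
    (4,30), (1,31)])) (Close 8 [(1,13), (2,27), (1,19), (2,30), (2,18)])) (Threshold 9 1
    (Threshold 23 50 (Threshold 13 1 (Close 4 [(1,27), (1,19), (1,24)]) (Move 23 20 5 (Move 20
    16 2 (Move 16 13 1 (Close 0 [(1,21)]))))) (Close 8 [(2,2), (2,3), (2,22), (2,27), (1,17),
    (1,31)])) (Close 8 [(1,13), (2,22), (2,27), (1,19), (2,18)]))) (Close 0 [(1,3)])))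
    (Threshold 19 3 (Threshold 9 1 (Close 4 [(1,22), (1,27), (1,17), (1,24)]) (Move 23 20 1
    (Move 23 22 4 (Move 22 18 2 (Move 18 9 1 (Close 0 [(1,32)])))))) (Threshold 9 1 (Close 4
    [(1,22), (1,27), (1,17), (1,24)]) (Move 23 20 1 (Move 23 22 4 (Move 22 18 2 (Move 18 9 1
    (Close 0 [(1,7)])))))))) (Threshold 9 1 (Threshold 18 4 (Threshold 19 2 (Threshold 21 1
    (Close 8 [(2,2), (1,4), (1,13), (1,22), (1,27), (1,17), (1,24)]) (Threshold 23 54 (Threshold
    13 1 (Threshold 18 3 (Close 4 [(1,2), (1,33), (1,19), (1,20)]) (Close 4 [(1,2), (1,4),
    (1,19), (1,24)])) (Move 23 20 5 (Move 20 16 2 (Move 16 13 1 (Close 4 [(1,21), (2,15),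
    (1,19)]))))) (Close 0 [(1,2)]))) (Close 8 [(1,4), (1,22), (1,27), (1,17), (3,24), (1,31)]))
    (Close 0 [(1,2)])) (Close 0 [(1,14)]))) (Threshold 16 3 (Threshold 9 1 (Close 4 [(1,9),
    (1,17), (1,24), (1,34)]) (Move 23 22 5 (Move 22 18 2 (Move 18 9 1 (Close 8 [(1,9), (4,27),
    (2,28), (1,35)]))))) (Threshold 9 1 (Close 4 [(1,9), (1,17), (1,24), (1,26)]) (Move 23 20 1
    (Move 23 22 4 (Move 22 18 2 (Move 18 9 1 (Close 8 [(1,7), (2,13), (2,27), (1,17), (1,18),
    (1,28)]))))))))))))) (Threshold 23 50 (Threshold 23 49 (Close 8 [(1,13), (1,27), (1,19),
    (1,23), (2,24)]) (Threshold 9 1 (Close 8 [(1,13), (2,27), (1,19), (2,24)]) (Move 23 20 1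
    (Move 23 22 4 (Move 22 18 2 (Move 18 9 1 (Close 8 [(1,13), (2,27), (1,19), (2,28)])))))))
    (Close 8 [(2,36), (1,16), (1,37), (1,17), (2,23), (1,24), (1,18)]))) (Threshold 15 2
    (Threshold 19 2 (Threshold 20 1 (Close 8 [(2,0), (1,2), (1,3), (1,9), (1,23), (1,18),
    (1,26)]) (Threshold 21 1 (Close 8 [(1,2), (2,22), (1,37), (1,17), (2,23), (1,18)])
    (Threshold 22 1 (Close 8 [(1,0), (2,3), (1,4), (1,12), (1,33), (1,37), (1,17)]) (Threshold
    23 50 (Parity 20 (Close 8 [(1,0), (1,3), (1,17), (2,23), (1,29), (1,24), (1,18)]) (Parity 21
    (Close 8 [(1,0), (1,3), (1,13), (1,17), (2,23), (1,24), (1,18)]) (Parity 22 (Close 8 [(1,0),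
    (1,3), (2,6), (1,12), (1,13), (1,17), (1,18)]) (Parity 23 (Close 8 [(1,0), (1,3), (1,13),
    (1,17), (2,23), (1,24), (1,18)]) (Threshold 9 1 (Move 23 22 1 (Close 8 [(1,3), (2,12),
    (1,13), (2,27), (1,17)])) (Move 23 20 1 (Move 23 22 4 (Move 22 18 2 (Move 18 9 1 (Close 8
    [(1,7), (1,17), (1,29), (2,38), (2,28)])))))))))) (Close 8 [(2,0), (1,2), (2,3), (1,37),
    (1,17), (2,23), (1,18)]))))) (Close 8 [(1,0), (1,13), (1,22), (1,17), (2,23), (1,24),
    (1,18)])) (Close 8 [(1,3), (1,13), (1,22), (1,17), (2,23), (1,24), (1,18)]))) (Threshold 9 1
    (Close 8 [(1,2), (1,3), (1,7), (1,13), (2,27), (1,17), (1,24)]) (Move 23 20 1 (Move 23 22 4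
    (Move 22 18 2 (Move 18 9 1 (Close 8 [(2,7), (2,27), (1,19), (1,31), (1,32), (1,28)])))))))
    (Threshold 9 1 (Close 8 [(1,3), (1,4), (1,9), (2,27), (1,17), (2,24)]) (Move 23 20 1 (Move
    23 22 4 (Move 22 18 2 (Move 18 9 1 (Close 8 [(1,9), (4,27), (1,19), (2,28)]))))))) (Close 8
    [(1,1), (1,2), (1,3), (1,13), (1,16), (1,27), (1,23), (1,24)])) (Close 7 [(1,0), (1,1),
    (1,14), (1,21), (2,15), (1,19), (1,24)])) (Close 7 [(1,3), (1,13), (1,16), (1,39), (1,17),
    (2,23), (1,24)])) (Close 8 [(1,0), (1,1), (1,3), (1,13), (1,14), (2,23), (1,24)])) (Close 8
    [(1,0), (1,13), (1,14), (1,36), (2,23), (1,24), (1,40)])) (Close 7 [(1,0), (1,7), (1,13),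
    (2,14), (2,27), (1,19)]))) (Close 8 [(1,1), (1,3), (1,4), (1,6), (2,12), (1,13), (1,14)]))
    (Close 8 [(1,0), (1,1), (2,6), (1,9), (1,12), (1,13), (1,14)])) (Close 8 [(1,0), (1,1),
    (1,3), (2,6), (1,12), (1,13), (1,14)])) (Close 16 [(2,1), (1,3), (1,4), (5,6), (1,7), (2,9),
    (1,11), (3,12)])) (Close 16 [(2,1), (1,3), (6,6), (1,7), (2,9), (1,11), (3,12)])) (Close 8
    [(1,2), (1,4), (2,6), (1,8), (2,9), (1,10)])) (Close 24 [(5,0), (4,1), (4,2), (3,3), (2,5),
    (6,6), (1,7), (1,8)])) (Close 8 [(2,0), (1,1), (2,2), (1,3), (1,4), (1,5), (1,6)])"

lemma trees_weighted:
  "\<forall>es\<in>set trees. weighted_tree (\<lambda>u v. (u, v) \<in> set covers) (nth weights) 0 es \<and>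
     (\<forall>(u, v)\<in>set es. u < 24 \<and> v < 24)"
  by code_simp

lemma certificate_refutes:
  "refutes (set covers) (map (tree_cut 24 (nth weights)) trees) certificate
     ((0, 0, 1) # replicate 23 (0, 64, 1)) 64"
  by code_simp

section \<open>The pebbling number\<close>

lemma perms4_verts: "bruhat_verts 4 = set perms4"
proof (rule sym, rule card_subset_eq)
  show "finite (bruhat_verts 4)" by (simp add: bruhat_verts_def)
  have "set xs = {1..4} \<and> distinct xs" if "xs \<in> set perms4" for xs
    using that by (auto simp: perms4_def)
  then show "set perms4 \<subseteq> bruhat_verts 4"
    by (auto simp: bruhat_verts_def permutations_of_set_def)
  have "distinct perms4" "length perms4 = 24" by (simp_all add: perms4_def)
  then show "card (set perms4) = card (bruhat_verts 4)"
    by (simp add: bruhat_verts_def distinct_card fact_numeral)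
qed

text \<open>The bounded search for the position of the transposition lets rewriting decide adjacency.\<close>

lemma bruhat_adj_iff:
  "bruhat_adj xs ys \<longleftrightarrow> list_ex (\<lambda>i. ys = xs[i := xs ! Suc i, Suc i := xs ! i]) [0..<length xs - 1]"
  by (auto simp: bruhat_adj_def list_ex_iff less_diff_conv)

lemma covers_adj: "\<forall>(u, v)\<in>set covers. bruhat_adj (perms4 ! u) (perms4 ! v)"
  unfolding bruhat_adj_iff by code_simp

lemma bruhat_adj_map: "bruhat_adj xs ys \<Longrightarrow> bruhat_adj (map g xs) (map g ys)"
  by (auto simp: bruhat_adj_def map_update)

text \<open>The map \<open>f\<close> composes the permutations in the list with \<open>r\<close>. It sends the identity to
\<open>r\<close> and respects adjacency, since exchanging positions commutes with renaming values.\<close>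

lemma solvable_of_size_64:
  assumes r: "r \<in> bruhat_verts 4" and size: "config_size (bruhat_verts 4) p = 64"
  shows "solvable (bruhat_verts 4) bruhat_adj r p"
proof -
  let ?V = "bruhat_verts 4"
  define f where "f i = map (\<lambda>k. r ! (k - 1)) (perms4 ! i)" for i
  have r': "distinct r" "set r = {1..4}" "length r = 4"
    using r distinct_card[of r] by (auto simp: bruhat_verts_def permutations_of_set_def)
  have perm: "distinct (perms4 ! i)" "set (perms4 ! i) = {1..4}" if "i < 24" for i
    using nth_mem[of i perms4] that
    by (auto simp: perms4_verts[symmetric] bruhat_verts_def permutations_of_set_def perms4_def)
  have inj: "inj_on (\<lambda>k. r ! (k - 1)) {1..4}"
    using r' by (auto simp: inj_on_def nth_eq_iff_index_eq)
  have "r ! (k - 1) \<in> {1..4}" if "k \<in> {1..4}" for k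
    using that r'(2,3) nth_mem[of "k - 1" r] by auto
  then have img: "(\<lambda>k. r ! (k - 1)) ` {1..4} = {1..4}"
    using inj by (intro endo_inj_surj) auto
  have f_verts: "f i \<in> ?V" if "i < 24" for i
    using perm[OF that] inj img
    by (simp add: f_def bruhat_verts_def permutations_of_set_def distinct_map)
  have f_inj: "inj_on f {..<24}"
  proof (rule inj_onI)
    fix i j assume ij: "i \<in> {..<24}" "j \<in> {..<24::nat}" "f i = f j"
    then have "perms4 ! i = perms4 ! j"
      using perm(2)[of i] perm(2)[of j] inj
      by (intro map_inj_on[of "\<lambda>k. r ! (k - 1)" "perms4 ! i" "perms4 ! j"]) (simp_all add: f_def)
    moreover have "distinct perms4" "length perms4 = 24" by (simp_all add: perms4_def)
    ultimately show "i = j" using ij by (simp add: nth_eq_iff_index_eq)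
  qed
  have "f ` {..<24} = ?V"
  proof (rule card_subset_eq)
    show "finite ?V" by (simp add: bruhat_verts_def)
    show "f ` {..<24} \<subseteq> ?V" using f_verts by auto
    show "card (f ` {..<24}) = card ?V"
      using f_inj by (simp add: card_image bruhat_verts_def fact_numeral)
  qed
  then have "bij_betw f {..<24} ?V" using f_inj by (simp add: bij_betw_def)
  then have "(\<Sum>i<24. p (f i)) = config_size ?V p"
    unfolding config_size_def by (rule sum.reindex_bij_betw)
  with size have p_sum: "(\<Sum>i<24. p (f i)) = 64" by simp
  have total: "64 \<le> (\<Sum>i<24. int ((p \<circ> f) i))"
    by (simp add: p_sum flip: of_nat_sum)
  have "r = map (nth r) [0..<4]" by (metis map_nth r'(3))
  also have "\<dots> = f 0" by (simp add: f_def perms4_def upt_rec numeral_2_eq_2 numeral_3_eq_3)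
  finally have q0: "r = f 0" .
  show ?thesis
  proof (cases "p r = 0")
    case False
    then show ?thesis by (intro solvable_root) simp
  next
    case True
    \<comment> \<open>With an empty root and 64 pebbles in total, the configuration lies in the box that the certificate starts from.\<close>
    have box: "in_box (p \<circ> f) ((0, 0, 1) # replicate 23 (0, 64, 1))"
    proof -
      have "p (f i) \<le> 64" if "i < 24" for i
        using member_le_sum[of i "{..<24}" "\<lambda>i. p (f i)"] that p_sum by simp
      then show ?thesis
        using True q0 by (auto simp: in_box_def nth_Cons' )
    qed
    have cuts: "\<forall>c\<in>set (map (tree_cut 24 (nth weights)) trees). pebbling_cut (set covers) 24 c"
      using trees_weighted by (auto intro!: pebbling_cut_tree_cut)
    have "solvable {..<24} (\<lambda>u v. (u, v) \<in> set covers) 0 (p \<circ> f)"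
      by (rule refutes_sound[OF cuts certificate_refutes box _ total]) simp
    moreover have "bruhat_adj (f u) (f v)" if "(u, v) \<in> set covers" for u v
      unfolding f_def using covers_adj that by (intro bruhat_adj_map) auto
    ultimately have "solvable ?V bruhat_adj (f 0) p"
      using f_inj f_verts by (intro solvable_embedding[where f = f and V = "{..<24}"]) auto
    then show ?thesis by (simp flip: q0)
  qed
qed

definition inversions :: "nat list \<Rightarrow> nat" where
  "inversions xs = (\<Sum>i\<leftarrow>[0..<length xs]. \<Sum>j\<leftarrow>[0..<i]. if xs ! i < xs ! j then 1 else 0)"

lemma weight_adj:
  "\<forall>xs\<in>set perms4. \<forall>ys\<in>set perms4. bruhat_adj xs ys \<longrightarrow>
     (2::nat) ^ (6 - inversions ys) \<le> 2 * 2 ^ (6 - inversions xs)"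
  unfolding bruhat_adj_iff by code_simp

lemma unsolvable_below_64:
  assumes "k < 64"
  shows "\<not> solvable (bruhat_verts 4) bruhat_adj [1, 2, 3, 4] (\<lambda>v. if v = [4, 3, 2, 1] then k else 0)"
    (is "\<not> solvable ?V _ ?id ?p")
proof
  assume sol: "solvable ?V bruhat_adj ?id ?p"
  let ?h = "\<lambda>xs. 2 ^ (6 - inversions xs) :: nat"
  have id: "?id \<in> ?V" and w0: "[4, 3, 2, 1] \<in> ?V" by (simp_all add: perms4_verts perms4_def)
  have fin: "finite ?V" by (simp add: perms4_verts)
  have irr: "\<not> bruhat_adj v v" if "v \<in> ?V" for v
    using bruhat_adj_neq that by blast
  have "?h v \<le> 2 * ?h u" if "u \<in> ?V" "v \<in> ?V" "bruhat_adj u v" for u v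
    using weight_adj that by (simp add: perms4_verts)
  from weight_of_solvable[OF fin id irr this sol]
  have "?h ?id \<le> (\<Sum>v\<in>?V. ?h v * ?p v)" .
  also have "\<dots> = ?h [4, 3, 2, 1] * k"
    using fin w0 by (simp add: sum.delta if_distrib cong: if_cong)
  finally show False using assms by (simp add: inversions_def numeral_eq_Suc)
qed

theorem theorem3: "pebbling_number (bruhat_verts 4) bruhat_adj = 64"
  unfolding pebbling_number_def
proof (rule Least_equality)
  show "\<forall>r\<in>bruhat_verts 4. \<forall>p. config_size (bruhat_verts 4) p = 64 \<longrightarrow>
      solvable (bruhat_verts 4) bruhat_adj r p"
    using solvable_of_size_64 by blast
next
  fix k assume k: "\<forall>r\<in>bruhat_verts 4. \<forall>p. config_size (bruhat_verts 4) p = k \<longrightarrow>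
      solvable (bruhat_verts 4) bruhat_adj r p"
  let ?p = "\<lambda>v::nat list. if v = [4, 3, 2, 1] then k else 0"
  have "config_size (bruhat_verts 4) ?p = k"
    by (simp add: config_size_def perms4_verts) (simp add: perms4_def)
  moreover have "[1, 2, 3, 4] \<in> bruhat_verts 4" by (simp add: perms4_verts perms4_def)
  ultimately show "64 \<le> k"
    using k unsolvable_below_64[of k] by (meson not_less)
qed

end
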